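(* Let $(Q,\ast_i)$ be a finite indexed quandle, $A$ an abelian group (written multiplicatively) and $\phi:Q\times Q\to A$ an indexed quandle 2-cocycle. For a virtual knot diagram $K$ define $$\Phi_\phi(K)=\sum_{f}\prod_{x}\phi(a_x^f,b_x^f)^{w(x)}\in\mathbb{Z}[A],$$ where $f$ runs over all homomorphisms $IndQ_K\to(Q,\ast_i)$ (equivalently, colorings of the arcs), $x$ runs over all real crossings, and at $x$ the over-arc is colored $b_x^f$ and the under-arc to the right of the over-arc is colored $a_x^f$. Then $\Phi_\phi(K)$ is a virtual knot invariant.
   Context: An indexed quandle is a set $Q$ with binary operations $\ast_i$ ($i\in\mathbb{Z}$) such that: (1) $a\ast_0 a=a$; (2) for all $b,c$ and $i$ there is a unique $a$ with $a\ast_i b=c$; (3) $(a\ast_i b)\ast_j c=(a\ast_j c)\ast_i(b\ast_{j-i}c)$ for all $a,b,c$, $i,j$. An indexed quandle 2-cocycle is a map $\phi:Q\times Q\to A$ with $\phi(a,a)=1$ for all $a$ and $\phi(a,c)^{-1}\phi(a\ast_{i-j}b,c)\,\phi(a,b)\,\phi(a\ast_i c,b\ast_j c)^{-1}=1$ for all $a,b,c\in Q$ and $i,j\in\mathbb{Z}$. Chord index: in the Gauss diagram (counterclockwise circle, one chord per real crossing directed from over- to under-preimage and signed by the writhe $w$), $\mathrm{Ind}(c)=r_+(c)-r_-(c)-l_+(c)+l_-(c)$, where $r_\pm(c)$ (resp. $l_\pm(c)$) counts chords of sign $\pm$ interlacing $c$ with tail left (resp. right) and head right (resp. left) of the arrow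 $c$. $IndQ_K$: generated by the arcs of $K$ (pieces from undercrossing to undercrossing) with, at each real crossing of index $i$ with over-arc $b$, under-arc $a$ to the right of the over-arc (with respect to its orientation) and other under-arc $a'$, the relation $a'=a\ast_i b$. *)

theory Defs
  imports Main "HOL-Library.FuncSet"
begin

text \<open>The indexed operation a *_i b is written op i a b.\<close>

definition indexed_quandle :: "(int \<Rightarrow> 'q \<Rightarrow> 'q \<Rightarrow> 'q) \<Rightarrow> bool" where
  "indexed_quandle op \<longleftrightarrow>
     (\<forall>a. op 0 a a = a) \<and>
     (\<forall>i b c. \<exists>!a. op i a b = c) \<and>
     (\<forall>i j a b c. op j (op i a b) c = op i (op j a c) (op (j - i) b c))"

text \<open>The abelian group A is written additively here (the paper writes it
  multiplicatively).\<close>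

definition iq_cocycle :: "(int \<Rightarrow> 'q \<Rightarrow> 'q \<Rightarrow> 'q) \<Rightarrow> ('q \<Rightarrow> 'q \<Rightarrow> 'a::ab_group_add) \<Rightarrow> bool" where
  "iq_cocycle op \<phi> \<longleftrightarrow>
     (\<forall>a. \<phi> a a = 0) \<and>
     (\<forall>a b c i j. - \<phi> a c + \<phi> (op (i - j) a b) c + \<phi> a b - \<phi> (op i a c) (op j b c) = 0)"

text \<open>A (virtual) knot diagram is represented by its Gauss diagram: the Gauss word
  read along the (counterclockwise) circle, each entry a crossing label together with
  True for the over-preimage (tail of the chord) and False for the under-preimage
  (head of the chord), and the sign (writhe) of each crossing.\<close>

type_synonym gdiag = "(nat \<times> bool) list \<times> (nat \<Rightarrow> int)"

definition labels :: "(nat \<times> bool) list \<Rightarrow> nat set" where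
  "labels g = fst ` set g"

definition gd_wf :: "gdiag \<Rightarrow> bool" where
  "gd_wf K \<longleftrightarrow> distinct (fst K) \<and>
     (\<forall>c\<in>labels (fst K). (c, True) \<in> set (fst K) \<and> (c, False) \<in> set (fst K)
        \<and> (snd K c = 1 \<or> snd K c = -1))"

definition over_pos :: "(nat \<times> bool) list \<Rightarrow> nat \<Rightarrow> nat" where
  "over_pos g c = (THE p. p < length g \<and> g ! p = (c, True))"

definition under_pos :: "(nat \<times> bool) list \<Rightarrow> nat \<Rightarrow> nat" where
  "under_pos g c = (THE p. p < length g \<and> g ! p = (c, False))"

definition cyc_between :: "nat \<Rightarrow> nat \<Rightarrow> nat \<Rightarrow> bool" where
  "cyc_between a p b = (if a < b then a < p \<and> p < b else a < p \<or> p < b)"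

text \<open>Positions on the right of the arrow of chord c: the counterclockwise arc
  from its tail to its head.\<close>

definition rside :: "(nat \<times> bool) list \<Rightarrow> nat \<Rightarrow> nat set" where
  "rside g c = {p. p < length g \<and> cyc_between (over_pos g c) p (under_pos g c)}"

text \<open>Ind(c) = r_+ - r_- - l_+ + l_-: an interlacing chord d with tail left and head
  right contributes w(d), one with tail right and head left contributes -w(d);
  non-interlacing chords contribute 0.\<close>

definition chord_index :: "gdiag \<Rightarrow> nat \<Rightarrow> int" where
  "chord_index K c = (\<Sum>d\<in>labels (fst K) - {c}.
     snd K d * (of_bool (under_pos (fst K) d \<in> rside (fst K) c)
                - of_bool (over_pos (fst K) d \<in> rside (fst K) c)))"

definition upos :: "(nat \<times> bool) list \<Rightarrow> nat set" where
  "upos g = {p. p < length g \<and> \<not> snd (g ! p)}"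

text \<open>An arc is identified with the position of the undercrossing where it starts;
  a diagram without real crossings has a single arc (named 0).\<close>

definition arcs :: "(nat \<times> bool) list \<Rightarrow> nat set" where
  "arcs g = (if upos g = {} then {0} else upos g)"

text \<open>The arc containing the part of the circle just before position p.\<close>

definition prev_under :: "(nat \<times> bool) list \<Rightarrow> nat \<Rightarrow> nat" where
  "prev_under g p = (if \<exists>q\<in>upos g. q < p then Max {q\<in>upos g. q < p} else Max (upos g))"

definition over_arc :: "(nat \<times> bool) list \<Rightarrow> nat \<Rightarrow> nat" where
  "over_arc g c = prev_under g (over_pos g c)"

definition in_arc :: "(nat \<times> bool) list \<Rightarrow> nat \<Rightarrow> nat" where
  "in_arc g c = prev_under g (under_pos g c)"

definition out_arc :: "(nat \<times> bool) list \<Rightarrow> nat \<Rightarrow> nat" where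
  "out_arc g c = under_pos g c"

text \<open>Under-arc to the right of the over-arc: the incoming one at a positive
  crossing, the outgoing one at a negative crossing.\<close>

definition right_arc :: "gdiag \<Rightarrow> nat \<Rightarrow> nat" where
  "right_arc K c = (if snd K c = 1 then in_arc (fst K) c else out_arc (fst K) c)"

definition other_arc :: "gdiag \<Rightarrow> nat \<Rightarrow> nat" where
  "other_arc K c = (if snd K c = 1 then out_arc (fst K) c else in_arc (fst K) c)"

text \<open>Homomorphisms IndQ_K \<rightarrow> Q = colorings of the arcs satisfying a' = a *_i b at
  every real crossing.\<close>

definition colorings :: "(int \<Rightarrow> 'q \<Rightarrow> 'q \<Rightarrow> 'q) \<Rightarrow> gdiag \<Rightarrow> (nat \<Rightarrow> 'q) set" where
  "colorings op K = {f \<in> arcs (fst K) \<rightarrow>\<^sub>E UNIV.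
     \<forall>c\<in>labels (fst K). f (other_arc K c) = op (chord_index K c) (f (right_arc K c)) (f (over_arc (fst K) c))}"

definition cweight :: "('q \<Rightarrow> 'q \<Rightarrow> 'a::ab_group_add) \<Rightarrow> gdiag \<Rightarrow> (nat \<Rightarrow> 'q) \<Rightarrow> 'a" where
  "cweight \<phi> K f = (\<Sum>c\<in>labels (fst K).
     (if snd K c = 1 then \<phi> (f (right_arc K c)) (f (over_arc (fst K) c))
      else - \<phi> (f (right_arc K c)) (f (over_arc (fst K) c))))"

text \<open>Elements of the group ring Z[A] are represented as functions A \<Rightarrow> int
  (coefficient of each group element); \<Phi> = \<Sum>_f [weight f].\<close>

definition Phi :: "(int \<Rightarrow> 'q \<Rightarrow> 'q \<Rightarrow> 'q) \<Rightarrow> ('q \<Rightarrow> 'q \<Rightarrow> 'a::ab_group_add) \<Rightarrow> gdiag \<Rightarrow> ('a \<Rightarrow> int)" where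
  "Phi op \<phi> K = (\<lambda>x. \<Sum>f\<in>colorings op K. if cweight \<phi> K f = x then 1 else 0)"

definition rot_move :: "gdiag \<Rightarrow> gdiag \<Rightarrow> bool" where
  "rot_move K K' \<longleftrightarrow> fst K' = rotate1 (fst K) \<and> snd K' = snd K"

definition relabel_move :: "gdiag \<Rightarrow> gdiag \<Rightarrow> bool" where
  "relabel_move K K' \<longleftrightarrow> (\<exists>f. inj_on f (labels (fst K)) \<and>
     fst K' = map (apfst f) (fst K) \<and> (\<forall>c\<in>labels (fst K). snd K' (f c) = snd K c))"

definition r1_move :: "gdiag \<Rightarrow> gdiag \<Rightarrow> bool" where
  "r1_move K K' \<longleftrightarrow> (\<exists>A B c e ov. c \<notin> labels (fst K) \<and> (e = 1 \<or> e = -1) \<and>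
     fst K = A @ B \<and> fst K' = A @ [(c, ov), (c, \<not> ov)] @ B \<and> snd K' = (snd K)(c := e))"

definition r2_move :: "gdiag \<Rightarrow> gdiag \<Rightarrow> bool" where
  "r2_move K K' \<longleftrightarrow> (\<exists>A B C c d e rv. c \<notin> labels (fst K) \<and> d \<notin> labels (fst K) \<and> c \<noteq> d \<and>
     (e = 1 \<or> e = -1) \<and> fst K = A @ B @ C \<and>
     fst K' = A @ [(c, True), (d, True)] @ B @
        (if rv then [(d, False), (c, False)] else [(c, False), (d, False)]) @ C \<and>
     snd K' = (snd K)(c := e, d := - e))"

definition sgnb :: "bool \<Rightarrow> int" where
  "sgnb b = (if b then 1 else -1)"

text \<open>Three chords x (top over middle), y (top over bottom), z (middle over bottom);
  sT: x before y on the top strand, sM: x before z on the middle strand,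
  sB: y before z on the bottom strand.  The move reverses each of the three pairs.\<close>

definition segT :: "nat \<Rightarrow> nat \<Rightarrow> bool \<Rightarrow> (nat \<times> bool) list" where
  "segT x y b = (if b then [(x, True), (y, True)] else [(y, True), (x, True)])"

definition segM :: "nat \<Rightarrow> nat \<Rightarrow> bool \<Rightarrow> (nat \<times> bool) list" where
  "segM x z b = (if b then [(x, False), (z, True)] else [(z, True), (x, False)])"

definition segB :: "nat \<Rightarrow> nat \<Rightarrow> bool \<Rightarrow> (nat \<times> bool) list" where
  "segB y z b = (if b then [(y, False), (z, False)] else [(z, False), (y, False)])"

definition r3_move :: "gdiag \<Rightarrow> gdiag \<Rightarrow> bool" where
  "r3_move K K' \<longleftrightarrow> (\<exists>A B C D x y z sT sM sB. distinct [x, y, z] \<and>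
     sgnb sT * sgnb sM = snd K y * snd K z \<and>
     sgnb sT * sgnb sB = snd K x * snd K z \<and>
     snd K' = snd K \<and>
     ((fst K = A @ segT x y sT @ B @ segM x z sM @ C @ segB y z sB @ D \<and>
       fst K' = A @ segT x y (\<not> sT) @ B @ segM x z (\<not> sM) @ C @ segB y z (\<not> sB) @ D) \<or>
      (fst K = A @ segT x y sT @ B @ segB y z sB @ C @ segM x z sM @ D \<and>
       fst K' = A @ segT x y (\<not> sT) @ B @ segB y z (\<not> sB) @ C @ segM x z (\<not> sM) @ D)))"

definition gd_move :: "gdiag \<Rightarrow> gdiag \<Rightarrow> bool" where
  "gd_move K K' \<longleftrightarrow> gd_wf K \<and> gd_wf K' \<and>
     (rot_move K K' \<or> relabel_move K K' \<or> r1_move K K' \<or> r2_move K K' \<or> r3_move K K')"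

definition virt_equiv :: "gdiag \<Rightarrow> gdiag \<Rightarrow> bool" where
  "virt_equiv = (\<lambda>K K'. gd_move K K' \<or> gd_move K' K)\<^sup>*\<^sup>*"

end

theory Submission
  imports Defs
begin

text \<open>Walking once along the Gauss word, a coloring is determined by the color q at the base point
  and the colors u c of the over-arcs: each undercrossing c turns the current color a into
  a *_i u c or its inverse, each overcrossing checks that the current color is u c, and the walk
  must close up. In this form colorings and weights are compositional under concatenation, so
  that the moves become local identities. The same holds for the indices: if every
  undercrossing raises and every overcrossing lowers a height by the sign of its chord, the total
  change is 0, and Ind(c) is the sign of c plus the height at its head minus the height at its
  tail. Hence each move preserves the indices of the surviving chords, the indices of the
  two chords of a second move agree, and those of a third move satisfy
  Ind(y) = Ind(x) + Ind(z), which is exactly what the third axiom and the cocycle condition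
  require.\<close>

subsection \<open>Colorings read along the Gauss word\<close>

primrec run :: "(nat \<Rightarrow> 'q \<Rightarrow> 'q \<Rightarrow> 'q) \<Rightarrow> (nat \<Rightarrow> 'q) \<Rightarrow> (nat \<times> bool) list \<Rightarrow> 'q \<Rightarrow> 'q" where
  "run T u [] q = q"
| "run T u (e # w) q = run T u w (if snd e then q else T (fst e) q (u (fst e)))"

primrec ok :: "(nat \<Rightarrow> 'q \<Rightarrow> 'q \<Rightarrow> 'q) \<Rightarrow> (nat \<Rightarrow> 'q) \<Rightarrow> (nat \<times> bool) list \<Rightarrow> 'q \<Rightarrow> bool" where
  "ok T u [] q \<longleftrightarrow> True"
| "ok T u (e # w) q \<longleftrightarrow> (snd e \<longrightarrow> u (fst e) = q) \<and>
     ok T u w (if snd e then q else T (fst e) q (u (fst e)))"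

primrec wt :: "(nat \<Rightarrow> 'q \<Rightarrow> 'q \<Rightarrow> 'q) \<Rightarrow> (nat \<Rightarrow> 'q \<Rightarrow> 'q \<Rightarrow> 'a::ab_group_add) \<Rightarrow> (nat \<Rightarrow> 'q) \<Rightarrow>
    (nat \<times> bool) list \<Rightarrow> 'q \<Rightarrow> 'a" where
  "wt T V u [] q = 0"
| "wt T V u (e # w) q = (if snd e then 0 else V (fst e) q (u (fst e))) +
     wt T V u w (if snd e then q else T (fst e) q (u (fst e)))"

text \<open>Extensionality leaves \<open>u\<close> no freedom outside the labels of the word, so
  that states can match arc colorings one to one.\<close>

definition states :: "(nat \<Rightarrow> 'q \<Rightarrow> 'q \<Rightarrow> 'q) \<Rightarrow> (nat \<times> bool) list \<Rightarrow> ('q \<times> (nat \<Rightarrow> 'q)) set" where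
  "states T w = {(q, u). u \<in> extensional (labels w) \<and> ok T u w q \<and> run T u w q = q}"

definition state_sum :: "(nat \<Rightarrow> 'q \<Rightarrow> 'q \<Rightarrow> 'q) \<Rightarrow> (nat \<Rightarrow> 'q \<Rightarrow> 'q \<Rightarrow> 'a::ab_group_add) \<Rightarrow>
    (nat \<times> bool) list \<Rightarrow> 'a \<Rightarrow> int" where
  "state_sum T V w x = (\<Sum>(q, u)\<in>states T w. if wt T V u w q = x then 1 else 0)"

lemma labels_simps [simp]:
  "labels [] = {}" "labels (e # w) = insert (fst e) (labels w)" "labels (v @ w) = labels v \<union> labels w"
  by (auto simp: labels_def)

lemma run_append [simp]: "run T u (v @ w) q = run T u w (run T u v q)"
  by (induction v arbitrary: q) auto

lemma ok_append [simp]: "ok T u (v @ w) q \<longleftrightarrow> ok T u v q \<and> ok T u w (run T u v q)"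
  by (induction v arbitrary: q) auto

lemma wt_append [simp]: "wt T V u (v @ w) q = wt T V u v q + wt T V u w (run T u v q)"
  by (induction v arbitrary: q) (auto simp: add.assoc)

lemma run_cong:
  assumes "\<And>c. c \<in> labels w \<Longrightarrow> T c = T' c" "\<And>c. c \<in> labels w \<Longrightarrow> u c = u' c"
  shows "run T u w q = run T' u' w q"
  using assms by (induction w arbitrary: q) auto

lemma ok_cong:
  assumes "\<And>c. c \<in> labels w \<Longrightarrow> T c = T' c" "\<And>c. c \<in> labels w \<Longrightarrow> u c = u' c"
  shows "ok T u w q = ok T' u' w q"
  using assms by (induction w arbitrary: q) auto

lemma wt_cong:
  assumes "\<And>c. c \<in> labels w \<Longrightarrow> T c = T' c" "\<And>c. c \<in> labels w \<Longrightarrow> V c = V' c"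
    "\<And>c. c \<in> labels w \<Longrightarrow> u c = u' c"
  shows "wt T V u w q = wt T' V' u' w q"
  using assms by (induction w arbitrary: q) auto

lemma state_sum_cong:
  assumes "\<And>c. c \<in> labels w \<Longrightarrow> T c = T' c" "\<And>c. c \<in> labels w \<Longrightarrow> V c = V' c"
  shows "state_sum T V w = state_sum T' V' w"
proof -
  have "run T u w q = run T' u w q" for u q
    by (rule run_cong) (use assms in auto)
  moreover have "ok T u w q = ok T' u w q" for u q
    by (rule ok_cong) (use assms in auto)
  moreover have "wt T V u w q = wt T' V' u w q" for u q
    by (rule wt_cong) (use assms in auto)
  ultimately show ?thesis
    by (simp add: state_sum_def states_def fun_eq_iff)
qed

text \<open>A weight-preserving bijection of states: \<open>(i, j)\<close> is the map and
  \<open>(i', j')\<close> its inverse, so weights need comparing in one direction only.\<close>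

lemma state_sum_eqI:
  assumes "\<And>q u. (q, u) \<in> states T w \<Longrightarrow>
      (i q u, j q u) \<in> states T' w' \<and> i' (i q u) (j q u) = q \<and> j' (i q u) (j q u) = u \<and>
      wt T' V' (j q u) w' (i q u) = wt T V u w q"
    and "\<And>q u. (q, u) \<in> states T' w' \<Longrightarrow>
      (i' q u, j' q u) \<in> states T w \<and> i (i' q u) (j' q u) = q \<and> j (i' q u) (j' q u) = u"
  shows "state_sum T V w = state_sum T' V' w'"
proof
  fix x
  show "state_sum T V w x = state_sum T' V' w' x"
    unfolding state_sum_def
    by (rule sum.reindex_bij_witness[where i = "\<lambda>(q, u). (i' q u, j' q u)" and j = "\<lambda>(q, u). (i q u, j q u)"])
      (use assms in auto)
qed

lemma run_upd [simp]: "c \<notin> labels w \<Longrightarrow> run T (u(c := a)) w q = run T u w q"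
  by (rule run_cong) auto

lemma ok_upd [simp]: "c \<notin> labels w \<Longrightarrow> ok T (u(c := a)) w q = ok T u w q"
  by (rule ok_cong) auto

lemma wt_upd [simp]: "c \<notin> labels w \<Longrightarrow> wt T V (u(c := a)) w q = wt T V u w q"
  by (rule wt_cong) auto

text \<open>Positional form of the recursion, needed because arcs are named by positions.
  \<open>take p\<close> stops before entry \<open>p\<close>, so \<open>run\<close> gives the color
  on arrival there.\<close>

lemma ok_iff_nth:
  "ok T u w q \<longleftrightarrow> (\<forall>p<length w. snd (w ! p) \<longrightarrow> u (fst (w ! p)) = run T u (take p w) q)"
  by (induction w arbitrary: q) (auto simp: All_less_Suc2)

lemma wt_eq_sum_nth:
  "wt T V u w q = (\<Sum>p<length w. if snd (w ! p) then 0
      else V (fst (w ! p)) (run T u (take p w) q) (u (fst (w ! p))))"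
  by (induction w arbitrary: q) (auto simp: sum.lessThan_Suc_shift simp del: sum.lessThan_Suc intro!: sum.cong)

lemma run_take_Suc:
  "p < length w \<Longrightarrow> run T u (take (Suc p) w) q =
     (if snd (w ! p) then run T u (take p w) q
      else T (fst (w ! p)) (run T u (take p w) q) (u (fst (w ! p))))"
  by (simp add: take_Suc_conv_app_nth)

section \<open>The effect of each move on the state sum of a word\<close>

text \<open>Moving the base point past \<open>e\<close> changes only the base color, and by the
  closing condition the walk along \<open>w\<close> undoes this change.\<close>

lemma state_sum_rotate: "state_sum T V (e # w) = state_sum T V (w @ [e])"
  by (rule state_sum_eqI[where i = "\<lambda>q u. run T u [e] q" and j = "\<lambda>q u. u"
        and i' = "\<lambda>q u. run T u w q" and j' = "\<lambda>q u. u"])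
    (auto simp: states_def add.commute split: if_splits)

lemma run_relabel:
  assumes "\<And>c. c \<in> labels w \<Longrightarrow> T' (f c) = T c"
  shows "run T' u (map (apfst f) w) q = run T (u \<circ> f) w q"
  using assms by (induction w arbitrary: q) auto

lemma ok_relabel:
  assumes "\<And>c. c \<in> labels w \<Longrightarrow> T' (f c) = T c"
  shows "ok T' u (map (apfst f) w) q = ok T (u \<circ> f) w q"
  using assms by (induction w arbitrary: q) auto

lemma wt_relabel:
  assumes "\<And>c. c \<in> labels w \<Longrightarrow> T' (f c) = T c" "\<And>c. c \<in> labels w \<Longrightarrow> V' (f c) = V c"
  shows "wt T' V' u (map (apfst f) w) q = wt T V (u \<circ> f) w q"
  using assms by (induction w arbitrary: q) auto

lemma labels_relabel: "labels (map (apfst f) w) = f ` labels w"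
  by (induction w) auto

lemma state_sum_relabel:
  assumes "inj_on f (labels w)"
    and T: "\<And>c. c \<in> labels w \<Longrightarrow> T' (f c) = T c" and V: "\<And>c. c \<in> labels w \<Longrightarrow> V' (f c) = V c"
  shows "state_sum T V w = state_sum T' V' (map (apfst f) w)"
proof (rule state_sum_eqI[where i = "\<lambda>q u. q" and i' = "\<lambda>q u. q"
      and j = "\<lambda>q u. restrict (u \<circ> inv_into (labels w) f) (f ` labels w)"
      and j' = "\<lambda>q u. restrict (u \<circ> f) (labels w)"], goal_cases)
  case (1 q u)
  let ?u = "restrict (u \<circ> inv_into (labels w) f) (f ` labels w)"
  have eq: "(?u \<circ> f) c = u c" if "c \<in> labels w" for c
    using that assms(1) by simp
  have "restrict (?u \<circ> f) (labels w) = u"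
    using 1 eq by (auto simp: states_def extensional_def fun_eq_iff)
  then show ?case
    using 1 eq run_cong[of w T T "?u \<circ> f" u] ok_cong[of w T T "?u \<circ> f" u]
      wt_cong[of w T T V V "?u \<circ> f" u]
    by (auto simp: states_def run_relabel[of w T' f T, OF T] ok_relabel[of w T' f T, OF T]
        wt_relabel[of w T' f T V' V, OF T V] labels_relabel)
next
  case (2 q u)
  let ?u = "restrict (u \<circ> f) (labels w)"
  have "restrict (?u \<circ> inv_into (labels w) f) (f ` labels w) = u"
    using 2 assms(1) by (auto simp: states_def extensional_def fun_eq_iff labels_relabel)
  then show ?case
    using 2 run_cong[of w T T "?u" "u \<circ> f"] ok_cong[of w T T "?u" "u \<circ> f"]
    by (auto simp: states_def run_relabel[of w T' f T, OF T] ok_relabel[of w T' f T, OF T])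
qed

text \<open>The over-color of the new chord is forced to be the color of its strand, so states
  extend uniquely; the undercrossing then neither changes the color nor adds weight.\<close>

lemma state_sum_r1:
  assumes c: "c \<notin> labels (A @ B)"
    and T: "\<And>a. T c a a = a" "\<And>a b. T c a b = b \<Longrightarrow> a = b" and V: "\<And>a. V c a a = 0"
  shows "state_sum T V (A @ B) = state_sum T V (A @ [(c, ov), (c, \<not> ov)] @ B)"
proof (rule state_sum_eqI[where i = "\<lambda>q u. q" and i' = "\<lambda>q u. q"
      and j = "\<lambda>q u. u(c := run T u A q)" and j' = "\<lambda>q u. u(c := undefined)"], goal_cases)
  case (1 q u)
  then show ?case
    using c T(1) V by (cases ov) (auto simp: states_def extensional_def)
next
  case (2 q u)
  \<comment> \<open>With the overcrossing first this is the check made there; with the undercrossing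
    first, the color after it must equal \<open>u c\<close>, and \<open>T(2)\<close>
    applies.\<close>
  have "u c = run T u A q"
    using 2 T(2)[of "run T u A q" "u c"] by (cases ov) (auto simp: states_def)
  then show ?case
    using 2 c T(1) by (cases ov) (auto simp: states_def extensional_def)
qed

text \<open>Both new over-colors are forced to be the color of the upper strand, and the two
  consecutive undercrossings cancel in color and in weight. Hypotheses appear in both orders because
  \<open>rv\<close> decides which is passed first.\<close>

lemma state_sum_r2:
  assumes cd: "c \<notin> labels (A @ B @ C)" "d \<notin> labels (A @ B @ C)" "c \<noteq> d"
    and T: "\<And>a b. T d (T c a b) b = a" "\<And>a b. T c (T d a b) b = a"
    and V: "\<And>a b. V c a b + V d (T c a b) b = 0" "\<And>a b. V d a b + V c (T d a b) b = 0"
  shows "state_sum T V (A @ B @ C) = state_sum T V (A @ [(c, True), (d, True)] @ B @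
        (if rv then [(d, False), (c, False)] else [(c, False), (d, False)]) @ C)"
proof (rule state_sum_eqI[where i = "\<lambda>q u. q" and i' = "\<lambda>q u. q"
      and j = "\<lambda>q u. u(c := run T u A q, d := run T u A q)"
      and j' = "\<lambda>q u. u(c := undefined, d := undefined)"], goal_cases)
  case (1 q u)
  have V': "V c a b + (V d (T c a b) b + x) = x" "V d a b + (V c (T d a b) b + x) = x" for a b x
    using V by (metis add.assoc add.left_neutral)+
  show ?case
    using 1 cd T by (cases rv) (auto simp: states_def extensional_def V V' add.assoc)
next
  case (2 q u)
  have "u c = run T u A q" "u d = run T u A q"
    using 2 cd by (auto simp: states_def)
  then show ?case
    using 2 cd T by (cases rv) (auto simp: states_def extensional_def)
qed

text \<open>At a third move only the color of the middle strand over z changes: it is read off before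
  instead of after the crossing x, or conversely. Ti is the inverse of T x in its first argument.\<close>

definition upd_r3 :: "(nat \<Rightarrow> 'q \<Rightarrow> 'q \<Rightarrow> 'q) \<Rightarrow> ('q \<Rightarrow> 'q \<Rightarrow> 'q) \<Rightarrow> nat \<Rightarrow> nat \<Rightarrow> bool \<Rightarrow> (nat \<Rightarrow> 'q) \<Rightarrow> nat \<Rightarrow> 'q" where
  "upd_r3 T Ti x z sM u = u(z := if sM then Ti (u z) (u x) else T x (u z) (u x))"

text \<open>Both orders of passing y and z along the bottom strand agree; b' and b are the colors over z
  when y comes first, respectively second.\<close>

definition r3_local :: "(nat \<Rightarrow> 'q \<Rightarrow> 'q \<Rightarrow> 'q) \<Rightarrow> (nat \<Rightarrow> 'q \<Rightarrow> 'q \<Rightarrow> 'a::ab_group_add) \<Rightarrow>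
    nat \<Rightarrow> nat \<Rightarrow> 'q \<Rightarrow> 'q \<Rightarrow> 'q \<Rightarrow> bool" where
  "r3_local T V y z b b' c \<longleftrightarrow> (\<forall>a. T z (T y a c) b' = T y (T z a b) c \<and>
     V y a c + V z (T y a c) b' = V z a b + V y (T z a b) c)"

lemma r3_state:
  assumes d: "distinct [x, y, z]" and xyz: "\<forall>v\<in>{x, y, z}. v \<notin> labels (A @ B @ C @ D)"
    and Ti: "\<And>a b. T x (Ti a b) b = a" "\<And>a b. Ti (T x a b) b = a"
    and loc: "\<And>b c. if sM = sB then r3_local T V y z b (T x b c) c else r3_local T V y z (T x b c) b c"
    and w: "(w = A @ segT x y sT @ B @ segM x z sM @ C @ segB y z sB @ D \<and>
       w' = A @ segT x y (\<not> sT) @ B @ segM x z (\<not> sM) @ C @ segB y z (\<not> sB) @ D) \<or>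
      (w = A @ segT x y sT @ B @ segB y z sB @ C @ segM x z sM @ D \<and>
       w' = A @ segT x y (\<not> sT) @ B @ segB y z (\<not> sB) @ C @ segM x z (\<not> sM) @ D)"
    and st: "(q, u) \<in> states T w"
  defines "u' \<equiv> upd_r3 T Ti x z sM u"
  shows "(q, u') \<in> states T w' \<and> upd_r3 T Ti x z (\<not> sM) u' = u \<and> wt T V u' w' q = wt T V u w q"
proof -
  \<comment> \<open>The top strand passes over both crossings, so its color does not change between
    them.\<close>
  have uy: "u y = u x" and okM: "\<exists>r. ok T u (segM x z sM) r"
    using w st by (elim disjE conjE; cases sT; force simp: states_def segT_def)+
  obtain b where uz: "u z = (if sM then T x b (u x) else b)"
    using okM by (cases sM) (auto simp: segM_def)
  have u': "u' x = u x" "u' y = u x" "u' z = (if sM then b else T x b (u x))"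
    using d uy uz Ti by (auto simp: u'_def upd_r3_def)
  have u'_out: "run T u' W r = run T u W r" "ok T u' W r = ok T u W r" "wt T V u' W r = wt T V u W r"
    if "z \<notin> labels W" for W r
    using that by (simp_all add: u'_def upd_r3_def)
  have T: "run T u' (segT x y (\<not> sT)) r = run T u (segT x y sT) r"
    "ok T u' (segT x y (\<not> sT)) r = ok T u (segT x y sT) r"
    "wt T V u' (segT x y (\<not> sT)) r = wt T V u (segT x y sT) r" for r
    using uy u' by (auto simp: segT_def)
  have M: "run T u' (segM x z (\<not> sM)) r = run T u (segM x z sM) r"
    "ok T u' (segM x z (\<not> sM)) r = ok T u (segM x z sM) r"
    "wt T V u' (segM x z (\<not> sM)) r = wt T V u (segM x z sM) r" for r
    using uz u' by (auto simp: segM_def dest: arg_cong[where f = "\<lambda>a. Ti a (u x)"] simp: Ti)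
  \<comment> \<open>\<open>b\<close> is the middle color before \<open>x\<close> and
    \<open>T x b (u x)\<close> the one after it. In one word \<open>z\<close> sees the earlier
    color, in the other the later one, and \<open>sM = sB\<close> decides which goes with
    \<open>y\<close> first.\<close>
  have B: "run T u' (segB y z (\<not> sB)) r = run T u (segB y z sB) r"
    "wt T V u' (segB y z (\<not> sB)) r = wt T V u (segB y z sB) r"
    "ok T u' (segB y z (\<not> sB)) r = ok T u (segB y z sB) r" for r
    using uy uz u' loc[of b "u x"] by (auto simp: segB_def r3_local_def split: if_splits)
  have z: "z \<notin> labels A" "z \<notin> labels B" "z \<notin> labels C" "z \<notin> labels D"
    using xyz by auto
  have "ok T u' w' q = ok T u w q" "run T u' w' q = run T u w q" "wt T V u' w' q = wt T V u w q"
    using w by (elim disjE conjE; simp add: T M B u'_out z)+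
  moreover have "labels w' = labels w" "z \<in> labels w"
    using w by (auto simp: segT_def segM_def segB_def)
  moreover have "upd_r3 T Ti x z (\<not> sM) u' = u"
    using d by (auto simp: u'_def upd_r3_def Ti)
  ultimately show ?thesis
    using st by (auto simp: states_def extensional_def u'_def upd_r3_def)
qed

text \<open>\<open>r3_state\<close> provides both directions, since negating \<open>sM\<close> and
  \<open>sB\<close> together keeps the local condition.\<close>

lemma state_sum_r3:
  assumes d: "distinct [x, y, z]" and xyz: "\<forall>v\<in>{x, y, z}. v \<notin> labels (A @ B @ C @ D)"
    and Ti: "\<And>a b. T x (Ti a b) b = a" "\<And>a b. Ti (T x a b) b = a"
    and loc: "\<And>b c. if sM = sB then r3_local T V y z b (T x b c) c else r3_local T V y z (T x b c) b c"
    and w: "(w = A @ segT x y sT @ B @ segM x z sM @ C @ segB y z sB @ D \<and>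
       w' = A @ segT x y (\<not> sT) @ B @ segM x z (\<not> sM) @ C @ segB y z (\<not> sB) @ D) \<or>
      (w = A @ segT x y sT @ B @ segB y z sB @ C @ segM x z sM @ D \<and>
       w' = A @ segT x y (\<not> sT) @ B @ segB y z (\<not> sB) @ C @ segM x z (\<not> sM) @ D)"
  shows "state_sum T V w = state_sum T V w'"
proof (rule state_sum_eqI[where i = "\<lambda>q u. q" and i' = "\<lambda>q u. q"
      and j = "\<lambda>q u. upd_r3 T Ti x z sM u" and j' = "\<lambda>q u. upd_r3 T Ti x z (\<not> sM) u"], goal_cases)
  case (1 q u)
  show ?case
    using r3_state[OF d xyz Ti loc w 1] by simp
next
  case (2 q u)
  have loc': "if (\<not> sM) = (\<not> sB) then r3_local T V y z b (T x b c) c else r3_local T V y z (T x b c) b c" for b c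
    using loc[of b c] by (cases "sM = sB") auto
  have w': "(w' = A @ segT x y (\<not> sT) @ B @ segM x z (\<not> sM) @ C @ segB y z (\<not> sB) @ D \<and>
       w = A @ segT x y (\<not> \<not> sT) @ B @ segM x z (\<not> \<not> sM) @ C @ segB y z (\<not> \<not> sB) @ D) \<or>
      (w' = A @ segT x y (\<not> sT) @ B @ segB y z (\<not> sB) @ C @ segM x z (\<not> sM) @ D \<and>
       w = A @ segT x y (\<not> \<not> sT) @ B @ segB y z (\<not> \<not> sB) @ C @ segM x z (\<not> \<not> sM) @ D)"
    using w by auto
  show ?case
    using r3_state[OF d xyz Ti loc' w' 2] by simp
qed

subsection \<open>The chord index as a difference of heights\<close>

definition val :: "(nat \<Rightarrow> int) \<Rightarrow> nat \<times> bool \<Rightarrow> int" where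
  "val s e = (if snd e then - s (fst e) else s (fst e))"

definition total :: "(nat \<Rightarrow> int) \<Rightarrow> (nat \<times> bool) list \<Rightarrow> int" where
  "total s w = (\<Sum>e\<leftarrow>w. val s e)"

primrec height :: "(nat \<Rightarrow> int) \<Rightarrow> (nat \<times> bool) list \<Rightarrow> nat \<times> bool \<Rightarrow> int" where
  "height s [] e = 0"
| "height s (f # w) e = (if e = f then 0 else val s f + height s w e)"

definition rise :: "gdiag \<Rightarrow> nat \<Rightarrow> int" where
  "rise K c = height (snd K) (fst K) (c, False) - height (snd K) (fst K) (c, True) + snd K c"

lemma total_simps [simp]:
  "total s [] = 0" "total s (e # w) = val s e + total s w" "total s (v @ w) = total s v + total s w"
  by (simp_all add: total_def)

lemma height_append:
  "height s (v @ w) e = (if e \<in> set v then height s v e else total s v + height s w e)"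
  by (induction v) auto

lemma total_cong: "(\<And>c. c \<in> labels w \<Longrightarrow> s c = s' c) \<Longrightarrow> total s w = total s' w"
  by (induction w) (auto simp: val_def)

lemma height_cong: "(\<And>c. c \<in> labels w \<Longrightarrow> s c = s' c) \<Longrightarrow> height s w e = height s' w e"
  by (induction w) (auto simp: val_def)

lemma height_nth: "distinct w \<Longrightarrow> p < length w \<Longrightarrow> height s w (w ! p) = (\<Sum>q<p. val s (w ! q))"
  by (induction w arbitrary: p)
    (auto simp: nth_Cons' sum.lessThan_Suc_shift gr0_conv_Suc in_set_conv_nth simp del: sum.lessThan_Suc)

section \<open>Entries and positions of a well-formed Gauss word\<close>

lemma set_eq_labels:
  assumes "gd_wf K"
  shows "set (fst K) = labels (fst K) \<times> UNIV"
proof (intro set_eqI iffI)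
  fix e assume "e \<in> labels (fst K) \<times> (UNIV :: bool set)"
  then show "e \<in> set (fst K)"
    using assms by (cases e; cases "snd e") (auto simp: gd_wf_def)
qed (force simp: labels_def)

lemma finite_labels [simp]: "finite (labels w)"
  by (simp add: labels_def)

lemma sum_over_entries:
  assumes "gd_wf K"
  shows "(\<Sum>e\<in>set (fst K). h e) = (\<Sum>c\<in>labels (fst K). h (c, True) + h (c, False))"
  unfolding set_eq_labels[OF assms]
  using sum.cartesian_product[of "\<lambda>c b. h (c, b)" "UNIV :: bool set" "labels (fst K)"]
  by (simp add: UNIV_bool add.commute)

text \<open>The two entries of a chord carry opposite values.\<close>

lemma total_eq_0: "gd_wf K \<Longrightarrow> total (snd K) (fst K) = 0"
  using sum_over_entries[of K "val (snd K)"]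
  by (simp add: total_def gd_wf_def sum_list_distinct_conv_sum_set val_def)

lemma over_pos_nth:
  assumes "distinct g" "p < length g" "g ! p = (c, True)"
  shows "over_pos g c = p"
  unfolding over_pos_def using assms nth_eq_iff_index_eq[of g] by (intro the_equality) metis+

lemma under_pos_nth:
  assumes "distinct g" "p < length g" "g ! p = (c, False)"
  shows "under_pos g c = p"
  unfolding under_pos_def using assms nth_eq_iff_index_eq[of g] by (intro the_equality) metis+

lemma over_pos_props:
  assumes "gd_wf K" "c \<in> labels (fst K)"
  shows "over_pos (fst K) c < length (fst K)" "fst K ! over_pos (fst K) c = (c, True)"
proof -
  have "(c, True) \<in> set (fst K)" "distinct (fst K)"
    using assms by (auto simp: gd_wf_def)
  then show "over_pos (fst K) c < length (fst K)" "fst K ! over_pos (fst K) c = (c, True)"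
    by (auto simp: in_set_conv_nth dest: over_pos_nth)
qed

lemma under_pos_props:
  assumes "gd_wf K" "c \<in> labels (fst K)"
  shows "under_pos (fst K) c < length (fst K)" "fst K ! under_pos (fst K) c = (c, False)"
proof -
  have "(c, False) \<in> set (fst K)" "distinct (fst K)"
    using assms by (auto simp: gd_wf_def)
  then show "under_pos (fst K) c < length (fst K)" "fst K ! under_pos (fst K) c = (c, False)"
    by (auto simp: in_set_conv_nth dest: under_pos_nth)
qed

text \<open>Prefix sums settle the range that does not wrap around. Otherwise its complement is the
  block from \<open>b\<close> to \<open>a\<close>, and the vanishing total makes one sum the
  negative of the other.\<close>

lemma sum_rside:
  fixes h :: "nat \<Rightarrow> int"
  assumes "(\<Sum>p<n. h p) = 0" "a < n" "b < n" "a \<noteq> b"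
  shows "(\<Sum>p | p < n \<and> cyc_between a p b. h p) = (\<Sum>p<b. h p) - (\<Sum>p<a. h p) - h a"
proof (cases "a < b")
  case True
  have "{..<b} = {..<a} \<union> {a} \<union> {p. p < n \<and> cyc_between a p b}"
    using True assms by (auto simp: cyc_between_def)
  moreover have "sum h ({..<a} \<union> {a} \<union> {p. p < n \<and> cyc_between a p b})
      = (\<Sum>p<a. h p) + h a + (\<Sum>p | p < n \<and> cyc_between a p b. h p)"
    using True by (subst sum.union_disjoint; (subst sum.union_disjoint)?) (auto simp: cyc_between_def)
  ultimately show ?thesis by simp
next
  case False
  have "{..<n} = {..a} - {..<b} \<union> {p. p < n \<and> cyc_between a p b}"
    using False assms by (auto simp: cyc_between_def)
  moreover have "sum h ({..a} - {..<b} \<union> {p. p < n \<and> cyc_between a p b})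
      = (\<Sum>p\<le>a. h p) - (\<Sum>p<b. h p) + (\<Sum>p | p < n \<and> cyc_between a p b. h p)"
    using False by (subst sum.union_disjoint; (subst sum_diff)?) (auto simp: cyc_between_def)
  ultimately show ?thesis
    using assms(1) by (simp flip: lessThan_Suc_atMost)
qed

text \<open>The values of all entries on the right of \<open>c\<close> add up to the index, since a
  chord with both ends there contributes 0. The same sum is a difference of prefix sums, that is, of
  heights.\<close>

lemma chord_index_eq_rise:
  assumes K: "gd_wf K" and c: "c \<in> labels (fst K)"
  shows "chord_index K c = rise K c"
proof -
  define g s a b where "g = fst K" and "s = snd K" and "a = over_pos g c" and "b = under_pos g c"
  define R where "R = rside g c"
  have d: "distinct g" using K by (simp add: gd_wf_def g_def)
  have ab: "a < length g" "b < length g" "g ! a = (c, True)" "g ! b = (c, False)"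
    using over_pos_props[OF K c] under_pos_props[OF K c] by (simp_all add: a_def b_def g_def)
  have cR: "a \<notin> R" "b \<notin> R"
    using ab by (auto simp: R_def rside_def cyc_between_def simp flip: a_def b_def split: if_splits)
  define pos where "pos e = (if snd e then over_pos g (fst e) else under_pos g (fst e))" for e
  have pos: "pos (g ! p) = p" if "p < length g" for p
    using over_pos_nth[OF d that] under_pos_nth[OF d that] by (cases "g ! p") (auto simp: pos_def)
  have "(\<Sum>p\<in>R. val s (g ! p)) = (\<Sum>p<length g. val s (g ! p) * of_bool (pos (g ! p) \<in> R))"
    by (rule sum.mono_neutral_cong_left) (auto simp: R_def rside_def pos)
  also have "\<dots> = (\<Sum>e\<in>set g. val s e * of_bool (pos e \<in> R))"
    by (rule sum.reindex_bij_betw[OF bij_betw_nth]) (auto simp: d)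
  also have "\<dots> = (\<Sum>d\<in>labels g. s d * (of_bool (under_pos g d \<in> R) - of_bool (over_pos g d \<in> R)))"
    unfolding g_def by (subst sum_over_entries[OF K])
      (auto simp: val_def pos_def g_def algebra_simps intro!: sum.cong)
  also have "\<dots> = chord_index K c"
    unfolding chord_index_def using c cR
    by (subst sum.remove[of _ c]) (auto simp: g_def s_def R_def a_def b_def)
  finally have "chord_index K c = (\<Sum>p\<in>R. val s (g ! p))" by simp
  also have "\<dots> = (\<Sum>p<b. val s (g ! p)) - (\<Sum>p<a. val s (g ! p)) - val s (g ! a)"
    unfolding R_def rside_def a_def[symmetric] b_def[symmetric]
  proof (rule sum_rside)
    show "(\<Sum>p<length g. val s (g ! p)) = 0"
      using total_eq_0[OF K] by (simp add: total_def sum_list_sum_nth g_def s_def atLeast0LessThan)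
  qed (use ab in auto)
  \<comment> \<open>The tail has the value minus the sign of \<open>c\<close>, so subtracting it
    produces the sign term of \<open>rise\<close>.\<close>
  also have "\<dots> = rise K c"
    using height_nth[OF d ab(1), of s] height_nth[OF d ab(2), of s] ab
    by (simp add: rise_def g_def s_def val_def)
  finally show ?thesis .
qed

subsection \<open>The state sum of a Gauss diagram\<close>

text \<open>The effect of passing under the color b at a crossing of sign s: THE selects the inverse
  of a' \<mapsto> op i a' b, which exists by the second quandle axiom.\<close>

definition act :: "(int \<Rightarrow> 'q \<Rightarrow> 'q \<Rightarrow> 'q) \<Rightarrow> int \<Rightarrow> int \<Rightarrow> 'q \<Rightarrow> 'q \<Rightarrow> 'q" where
  "act op s i a b = (if s = 1 then op i a b else (THE a'. op i a' b = a))"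

text \<open>The under-strand arrives on the right of the over-arc at a positive crossing and leaves
  on the right at a negative one. Hence the right-hand color is the input \<open>a\<close> in the
  first case and the output in the second.\<close>

definition act_weight :: "(int \<Rightarrow> 'q \<Rightarrow> 'q \<Rightarrow> 'q) \<Rightarrow> ('q \<Rightarrow> 'q \<Rightarrow> 'a::ab_group_add) \<Rightarrow> int \<Rightarrow> int \<Rightarrow>
    'q \<Rightarrow> 'q \<Rightarrow> 'a" where
  "act_weight op \<phi> s i a b = (if s = 1 then \<phi> a b else - \<phi> (act op s i a b) b)"

abbreviation diag_sum :: "(int \<Rightarrow> 'q \<Rightarrow> 'q \<Rightarrow> 'q) \<Rightarrow> ('q \<Rightarrow> 'q \<Rightarrow> 'a::ab_group_add) \<Rightarrow> gdiag \<Rightarrow> 'a \<Rightarrow> int" where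
  "diag_sum op \<phi> K \<equiv> state_sum (\<lambda>c. act op (snd K c) (rise K c))
     (\<lambda>c. act_weight op \<phi> (snd K c) (rise K c)) (fst K)"

lemma indexed_quandle_inverse:
  assumes "indexed_quandle op"
  shows "op i (THE a'. op i a' b = a) b = a" "(THE a'. op i a' b = op i a b) = a" "op i a b = op i a' b \<longleftrightarrow> a = a'"
proof -
  have ex: "\<exists>!a. op i a b = c" for i b c
    using assms[unfolded indexed_quandle_def, THEN conjunct2, THEN conjunct1] by (elim allE)
  have inj: "op i a b = op i a' b \<longleftrightarrow> a = a'" for a a'
    using ex1E[OF ex[of i b "op i a b"]] by metis
  show "op i (THE a'. op i a' b = a) b = a"
    by (rule theI'[OF ex[of i b a]])
  show "(THE a'. op i a' b = op i a b) = a"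
    unfolding inj by simp
  show "op i a b = op i a' b \<longleftrightarrow> a = a'"
    by (rule inj)
qed

lemma act_inverse:
  assumes "indexed_quandle op" "s = 1 \<or> s = -1"
  shows "act op s i (act op (- s) i a b) b = a" "act op (- s) i (act op s i a b) b = a"
  using assms(2) by (auto simp: act_def indexed_quandle_inverse[OF assms(1)])

lemma act_weight_cancel:
  assumes "indexed_quandle op" "s = 1 \<or> s = -1"
  shows "act_weight op \<phi> s i a b + act_weight op \<phi> (- s) i (act op s i a b) b = 0"
  using assms(2) by (auto simp: act_weight_def act_def indexed_quandle_inverse[OF assms(1)])

section \<open>Arcs and the undercrossings where they start\<close>

lemma finite_upos [simp]: "finite (upos g)"
  by (simp add: upos_def)

lemma prev_under_Suc:
  assumes "p < length g"
  shows "prev_under g (Suc p) = (if snd (g ! p) then prev_under g p else p)"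
proof (cases "snd (g ! p)")
  case True
  then have "q < Suc p \<longleftrightarrow> q < p" if "q \<in> upos g" for q
    using that by (auto simp: upos_def less_Suc_eq)
  then show ?thesis
    using True by (simp add: prev_under_def cong: conj_cong bex_cong)
next
  case False
  then have p: "p \<in> upos g"
    using assms by (simp add: upos_def)
  then have "Max {q \<in> upos g. q < Suc p} = p"
    by (intro Max_eqI) auto
  with p False show ?thesis
    by (auto simp: prev_under_def)
qed

text \<open>The end of the word lies on the arc that wraps around to the base point; with
  \<open>prev_under_0\<close> this yields the closing condition.\<close>

lemma prev_under_length: "upos g \<noteq> {} \<Longrightarrow> prev_under g (length g) = Max (upos g)"
proof -
  have "{q \<in> upos g. q < length g} = upos g"
    by (auto simp: upos_def)
  then show "upos g \<noteq> {} \<Longrightarrow> ?thesis"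
    by (auto simp: prev_under_def)
qed

lemma prev_under_0: "prev_under g 0 = Max (upos g)"
  by (simp add: prev_under_def)

lemma upos_nonempty:
  assumes "gd_wf K" "fst K \<noteq> []"
  shows "upos (fst K) \<noteq> {}"
proof -
  obtain c where "c \<in> labels (fst K)"
    using assms(2) by (cases "fst K") auto
  from under_pos_props[OF assms(1) this] show ?thesis
    by (auto simp: upos_def)
qed

lemma bij_betw_under_pos:
  assumes "gd_wf K"
  shows "bij_betw (under_pos (fst K)) (labels (fst K)) (upos (fst K))"
  unfolding bij_betw_def
proof (intro conjI set_eqI iffI)
  show "inj_on (under_pos (fst K)) (labels (fst K))"
    using under_pos_props(2)[OF assms] by (intro inj_onI) (metis prod.inject)
next
  fix p assume p: "p \<in> upos (fst K)"
  then have "under_pos (fst K) (fst (fst K ! p)) = p" "fst (fst K ! p) \<in> labels (fst K)"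
    using assms under_pos_nth[of "fst K" p "fst (fst K ! p)"]
    by (auto simp: upos_def gd_wf_def labels_def prod_eq_iff)
  then show "p \<in> under_pos (fst K) ` labels (fst K)"
    by (metis image_eqI)
next
  fix p assume "p \<in> under_pos (fst K) ` labels (fst K)"
  then show "p \<in> upos (fst K)"
    using under_pos_props[OF assms] by (auto simp: upos_def)
qed

section \<open>Arc colorings and states\<close>

text \<open>A diagram without crossings has one arc but an empty word, so its color has to be carried
  separately.\<close>

definition start_color :: "(nat \<times> bool) list \<Rightarrow> (nat \<Rightarrow> 'q) \<Rightarrow> 'q" where
  "start_color g f = (if g = [] then f 0 else f (prev_under g 0))"

definition over_colors :: "(nat \<times> bool) list \<Rightarrow> (nat \<Rightarrow> 'q) \<Rightarrow> nat \<Rightarrow> 'q" where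
  "over_colors g f = restrict (\<lambda>c. f (over_arc g c)) (labels g)"

text \<open>\<open>Suc p\<close> occurs because arc \<open>p\<close> begins just after the
  undercrossing at \<open>p\<close>.\<close>

definition arc_colors :: "(nat \<Rightarrow> 'q \<Rightarrow> 'q \<Rightarrow> 'q) \<Rightarrow> (nat \<times> bool) list \<Rightarrow> 'q \<Rightarrow> (nat \<Rightarrow> 'q) \<Rightarrow> nat \<Rightarrow> 'q" where
  "arc_colors T g q u = restrict (\<lambda>p. if g = [] then q else run T u (take (Suc p) g) q) (arcs g)"

text \<open>Solving each relation for the outgoing under-arc unifies the two signs: at a negative
  crossing the outgoing arc is the right-hand one, and \<open>act\<close> inverts the
  operation.\<close>

lemma coloring_iff:
  assumes "indexed_quandle op" "gd_wf K"
  shows "f \<in> colorings op K \<longleftrightarrow> f \<in> extensional (arcs (fst K)) \<and>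
    (\<forall>c\<in>labels (fst K). f (under_pos (fst K) c) =
       act op (snd K c) (rise K c) (f (prev_under (fst K) (under_pos (fst K) c))) (f (over_arc (fst K) c)))"
proof -
  have "f (other_arc K c) = op (chord_index K c) (f (right_arc K c)) (f (over_arc (fst K) c)) \<longleftrightarrow>
      f (under_pos (fst K) c) =
       act op (snd K c) (rise K c) (f (prev_under (fst K) (under_pos (fst K) c))) (f (over_arc (fst K) c))"
    if c: "c \<in> labels (fst K)" for c
  proof -
    have "snd K c = 1 \<or> snd K c = -1"
      using assms(2) c by (auto simp: gd_wf_def)
    then show ?thesis
      using chord_index_eq_rise[OF assms(2) c] indexed_quandle_inverse[OF assms(1)]
      by (auto simp: other_arc_def right_arc_def in_arc_def out_arc_def act_def)
  qed
  then show ?thesis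
    by (auto simp: colorings_def PiE_def)
qed

lemma cweight_eq:
  assumes "indexed_quandle op" "gd_wf K" "f \<in> colorings op K"
  shows "cweight \<phi> K f = (\<Sum>c\<in>labels (fst K). act_weight op \<phi> (snd K c) (rise K c)
     (f (prev_under (fst K) (under_pos (fst K) c))) (f (over_arc (fst K) c)))"
  unfolding cweight_def
proof (rule sum.cong)
  fix c assume c: "c \<in> labels (fst K)"
  then show "(if snd K c = 1 then \<phi> (f (right_arc K c)) (f (over_arc (fst K) c))
      else - \<phi> (f (right_arc K c)) (f (over_arc (fst K) c))) = act_weight op \<phi> (snd K c) (rise K c)
     (f (prev_under (fst K) (under_pos (fst K) c))) (f (over_arc (fst K) c))"
    using assms(3) unfolding coloring_iff[OF assms(1,2)]
    by (auto simp: act_weight_def right_arc_def in_arc_def out_arc_def)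
qed simp

lemma run_take_coloring:
  assumes K: "gd_wf K" and p: "p \<le> length (fst K)" and ne: "fst K \<noteq> []"
    and f: "\<And>c. c \<in> labels (fst K) \<Longrightarrow> f (under_pos (fst K) c) =
      T c (f (prev_under (fst K) (under_pos (fst K) c))) (f (over_arc (fst K) c))"
  shows "run T (over_colors (fst K) f) (take p (fst K)) (start_color (fst K) f) = f (prev_under (fst K) p)"
  using p
proof (induction p)
  case 0
  then show ?case
    using ne by (simp add: start_color_def)
next
  case (Suc p)
  obtain c b where cb: "fst K ! p = (c, b)"
    by (cases "fst K ! p")
  have c: "c \<in> labels (fst K)"
    using Suc.prems cb nth_mem[of p "fst K"] by (force simp: labels_def)
  have "under_pos (fst K) c = p" if "\<not> b"
    using that under_pos_nth[of "fst K" p c] Suc.prems cb K by (auto simp: gd_wf_def)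
  then show ?case
    using Suc f[OF c] c cb by (auto simp: run_take_Suc prev_under_Suc over_colors_def)
qed

lemma run_take_state:
  assumes p: "p \<le> length g" and st: "run T u g q = q" and ne: "upos g \<noteq> {}"
  shows "run T u (take p g) q = arc_colors T g q u (prev_under g p)"
proof -
  let ?f = "arc_colors T g q u"
  have f: "?f r = run T u (take (Suc r) g) q" if "r \<in> upos g" for r
    using that by (auto simp: arc_colors_def arcs_def upos_def)
  \<comment> \<open>Before the first undercrossing of the word no arc has started yet, so the color
    is still \<open>q\<close>.\<close>
  have *: "run T u (take p g) q = (if \<exists>r\<in>upos g. r < p then ?f (prev_under g p) else q)"
    if "p \<le> length g" for p
    using that
  proof (induction p)
    case (Suc p)
    have ex: "(\<exists>r\<in>upos g. r < Suc p) \<longleftrightarrow> \<not> snd (g ! p) \<or> (\<exists>r\<in>upos g. r < p)"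
    proof -
      have "p \<in> upos g \<longleftrightarrow> \<not> snd (g ! p)"
        using Suc.prems by (simp add: upos_def)
      then show ?thesis
        by (auto simp: less_Suc_eq)
    qed
    show ?case
    proof (cases "snd (g ! p)")
      case True
      then show ?thesis
        using Suc ex by (simp add: run_take_Suc prev_under_Suc)
    next
      case False
      moreover have "p \<in> upos g"
        using False Suc.prems by (simp add: upos_def)
      ultimately show ?thesis
        using Suc.prems f[of p] ex by (simp add: prev_under_Suc)
    qed
  qed simp
  \<comment> \<open>The closing condition identifies \<open>q\<close> with the color of the last
    arc, the one running through the base point.\<close>
  have "q = ?f (Max (upos g))"
    using *[of "length g"] st ne by (auto simp: prev_under_length upos_def)
  moreover have "prev_under g p = Max (upos g)" if "\<not> (\<exists>r\<in>upos g. r < p)"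
    using that by (auto simp: prev_under_def)
  ultimately show ?thesis
    using *[OF p] by auto
qed

text \<open>Reading off the base color and the over-colors is a bijection from colorings to states;
  its inverse records the color after each undercrossing. The five cases are the two inverse laws,
  each followed by a membership, and the equality of weights.\<close>

lemma Phi_eq_diag_sum:
  assumes op: "indexed_quandle op" and K: "gd_wf K"
  shows "Phi op \<phi> K = diag_sum op \<phi> K"
proof
  fix x
  define g where "g = fst K"
  define T where "T c = act op (snd K c) (rise K c)" for c
  define V where "V c = act_weight op \<phi> (snd K c) (rise K c)" for c
  note col = coloring_iff[OF op K, folded g_def T_def]
  have d: "distinct g" using K by (simp add: gd_wf_def g_def)
  note ov = over_pos_props[OF K, folded g_def] and un = under_pos_props[OF K, folded g_def]
  have lab: "fst (g ! p) \<in> labels g" if "p < length g" for p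
    using that by (auto simp: labels_def)
  have pos: "over_pos g (fst (g ! p)) = p" if "p < length g" "snd (g ! p)" for p
    using that by (intro over_pos_nth[OF d]) (auto simp: prod_eq_iff)
  have "Phi op \<phi> K x = (\<Sum>(q, u)\<in>states T g. if wt T V u g q = x then 1 else 0)"
    unfolding Phi_def
  proof (rule sum.reindex_bij_witness[where j = "\<lambda>f. (start_color g f, over_colors g f)"
        and i = "\<lambda>(q, u). arc_colors T g q u"], goal_cases)
    case (1 f)
    then have f: "f \<in> extensional (arcs g)"
      and f_un: "\<And>c. c \<in> labels g \<Longrightarrow> f (under_pos g c) = T c (f (prev_under g (under_pos g c))) (f (over_arc g c))"
      by (auto simp: col)
    have "arc_colors T g (start_color g f) (over_colors g f) p = f p" if p: "p \<in> arcs g" for p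
    proof (cases "g = []")
      case True
      then show ?thesis
        using p by (simp add: arc_colors_def start_color_def arcs_def upos_def)
    next
      case False
      then have "p \<in> upos g"
        using p upos_nonempty[OF K] by (simp add: arcs_def g_def)
      then show ?thesis
        using False p run_take_coloring[OF K, of "Suc p" f T, folded g_def, OF _ False f_un]
        by (auto simp: arc_colors_def upos_def prev_under_Suc)
    qed
    then show ?case
      using f by (auto simp: extensional_def arc_colors_def fun_eq_iff)
  next
    case (2 f)
    then have f_un: "\<And>c. c \<in> labels g \<Longrightarrow> f (under_pos g c) = T c (f (prev_under g (under_pos g c))) (f (over_arc g c))"
      by (auto simp: col)
    show ?case
    proof (cases "g = []")
      case True
      then show ?thesis
        by (simp add: states_def over_colors_def restrict_def)
    next
      case False
      note run = run_take_coloring[OF K, of _ f T, folded g_def, OF _ False f_un]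
      have ne: "upos g \<noteq> {}"
        using upos_nonempty[OF K] False by (simp add: g_def)
      have "ok T (over_colors g f) g (start_color g f)"
        unfolding ok_iff_nth using run lab pos by (auto simp: over_colors_def over_arc_def)
      moreover have "run T (over_colors g f) g (start_color g f) = start_color g f"
        using run[of "length g"] False ne by (simp add: start_color_def prev_under_length prev_under_0)
      ultimately show ?thesis
        by (simp add: states_def over_colors_def)
    qed
  next
    case (3 qu)
    obtain q u where qu: "qu = (q, u)" by (cases qu)
    have st: "u \<in> extensional (labels g)" "ok T u g q" "run T u g q = q"
      using 3 qu by (auto simp: states_def)
    show ?case
    proof (cases "g = []")
      case True
      then show ?thesis
        using st by (simp add: qu start_color_def over_colors_def arc_colors_def arcs_def upos_def restrict_def)
    next
      case False
      have ne: "upos g \<noteq> {}"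
        using upos_nonempty[OF K] False by (simp add: g_def)
      note run = run_take_state[OF _ st(3) ne]
      have "over_colors g (arc_colors T g q u) c = u c" for c
        using st(1,2) ov[of c] run[of "over_pos g c"]
        by (auto simp: over_colors_def over_arc_def ok_iff_nth extensional_def)
      then show ?thesis
        using run[of 0] False by (auto simp: qu start_color_def)
    qed
  next
    case (4 qu)
    obtain q u where qu: "qu = (q, u)" by (cases qu)
    have st: "u \<in> extensional (labels g)" "ok T u g q" "run T u g q = q"
      using 4 qu by (auto simp: states_def)
    show ?case
    proof (cases "g = []")
      case True
      then show ?thesis
        by (simp add: qu col arc_colors_def)
    next
      case False
      have ne: "upos g \<noteq> {}"
        using upos_nonempty[OF K] False by (simp add: g_def)
      note run = run_take_state[OF _ st(3) ne]
      have "arc_colors T g q u (under_pos g c) =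
          T c (arc_colors T g q u (prev_under g (under_pos g c))) (arc_colors T g q u (over_arc g c))"
        if c: "c \<in> labels g" for c
      proof -
        have "arc_colors T g q u (over_arc g c) = u c"
          using st(2) ov[OF c] run[of "over_pos g c"] by (auto simp: over_arc_def ok_iff_nth)
        moreover have "arc_colors T g q u (under_pos g c) = run T u (take (Suc (under_pos g c)) g) q"
          using un[OF c] False by (auto simp: arc_colors_def arcs_def upos_def)
        ultimately show ?thesis
          using un[OF c] run[of "under_pos g c"] by (simp add: run_take_Suc)
      qed
      then show ?thesis
        by (simp add: qu col arc_colors_def)
    qed
  next
    case (5 f)
    then have f_un: "\<And>c. c \<in> labels g \<Longrightarrow> f (under_pos g c) = T c (f (prev_under g (under_pos g c))) (f (over_arc g c))"
      by (auto simp: col)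
    have "wt T V (over_colors g f) g (start_color g f) = cweight \<phi> K f"
    proof (cases "g = []")
      case True
      then show ?thesis
        by (simp add: cweight_def flip: g_def)
    next
      case False
      note run = run_take_coloring[OF K, of _ f T, folded g_def, OF _ False f_un]
      have oc: "over_colors g f c = f (over_arc g c)" if "c \<in> labels g" for c
        using that by (simp add: over_colors_def)
      \<comment> \<open>Only undercrossings carry weight, and each chord has exactly one.\<close>
      have "wt T V (over_colors g f) g (start_color g f) =
          (\<Sum>p\<in>upos g. V (fst (g ! p)) (f (prev_under g p)) (f (over_arc g (fst (g ! p)))))"
        unfolding wt_eq_sum_nth
        by (rule sum.mono_neutral_cong_right) (auto simp: upos_def run oc lab)
      also have "\<dots> = (\<Sum>c\<in>labels g. V c (f (prev_under g (under_pos g c))) (f (over_arc g c)))"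
        by (subst sum.reindex_bij_betw[OF bij_betw_under_pos[OF K, folded g_def], symmetric])
          (auto simp: un intro!: sum.cong)
      also have "\<dots> = cweight \<phi> K f"
        using 5 by (simp add: cweight_eq[OF op K] V_def g_def)
      finally show ?thesis .
    qed
    then show ?case
      by simp
  qed
  then show "Phi op \<phi> K x = diag_sum op \<phi> K x"
    by (simp add: state_sum_def g_def T_def[abs_def] V_def[abs_def])
qed

subsection \<open>Invariance under the moves\<close>

lemma diag_sum_eq_state_sum:
  assumes "\<And>c. c \<in> labels (fst K) \<Longrightarrow> snd K c = s c \<and> rise K c = r c"
  shows "diag_sum op \<phi> K = state_sum (\<lambda>c. act op (s c) (r c)) (\<lambda>c. act_weight op \<phi> (s c) (r c)) (fst K)"
  by (rule state_sum_cong) (use assms in auto)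

lemma mem_labels_iff: "c \<in> labels w \<longleftrightarrow> (c, True) \<in> set w \<or> (c, False) \<in> set w"
proof
  assume "c \<in> labels w"
  then obtain b where "(c, b) \<in> set w"
    by (auto simp: labels_def)
  then show "(c, True) \<in> set w \<or> (c, False) \<in> set w"
    by (cases b) auto
qed (force simp: labels_def)

lemma notin_labels: "c \<notin> labels w \<Longrightarrow> (c, b) \<notin> set w"
  by (cases b) (auto simp: mem_labels_iff)

lemma total_upd [simp]: "c \<notin> labels w \<Longrightarrow> total (s(c := e)) w = total s w"
  by (rule total_cong) auto

lemma height_upd [simp]: "c \<notin> labels w \<Longrightarrow> height (s(c := e)) w f = height s w f"
  by (rule height_cong) auto

text \<open>Moving the first entry to the end lowers every height by the same amount, including that
  of the moved entry because the total is 0. Differences of heights survive.\<close>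

lemma diag_sum_rot:
  assumes K: "gd_wf K" and m: "rot_move K K'"
  shows "diag_sum op \<phi> K = diag_sum op \<phi> K'"
proof (cases "fst K")
  case Nil
  then have "K' = K"
    using m by (simp add: rot_move_def prod_eq_iff)
  then show ?thesis by simp
next
  case (Cons e w)
  have K': "fst K' = w @ [e]" "snd K' = snd K"
    using m Cons by (auto simp: rot_move_def)
  have "e \<notin> set w" "total (snd K) w = - val (snd K) e"
    using K Cons total_eq_0[OF K] by (auto simp: gd_wf_def)
  then have h: "height (snd K) (w @ [e]) f = height (snd K) (e # w) f - val (snd K) e" if "f \<in> set (e # w)" for f
    using that by (auto simp: height_append)
  have "rise K c = rise K' c" if "c \<in> labels (fst K)" for c
  proof -
    have "(c, b) \<in> set (e # w)" for b
      using set_eq_labels[OF K] that Cons by auto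
    then show ?thesis
      by (simp only: rise_def K' h Cons)
  qed
  then have "diag_sum op \<phi> K = state_sum (\<lambda>c. act op (snd K' c) (rise K' c))
      (\<lambda>c. act_weight op \<phi> (snd K' c) (rise K' c)) (fst K)"
    by (intro diag_sum_eq_state_sum) (simp add: K')
  then show ?thesis
    by (simp only: Cons K'(1) state_sum_rotate)
qed

lemma height_relabel:
  assumes "inj_on f (insert c (labels w))" "\<And>c. c \<in> labels w \<Longrightarrow> s' (f c) = s c"
  shows "height s' (map (apfst f) w) (f c, b) = height s w (c, b)"
  using assms by (induction w) (auto simp: val_def inj_on_def)

lemma diag_sum_relabel:
  assumes "relabel_move K K'"
  shows "diag_sum op \<phi> K = diag_sum op \<phi> K'"
proof -
  obtain f where f: "inj_on f (labels (fst K))" "fst K' = map (apfst f) (fst K)"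
    and s: "\<And>c. c \<in> labels (fst K) \<Longrightarrow> snd K' (f c) = snd K c"
    using assms by (auto simp: relabel_move_def)
  have "rise K' (f c) = rise K c" if c: "c \<in> labels (fst K)" for c
    using height_relabel[of f c "fst K" "snd K'" "snd K"] f s c by (simp add: rise_def insert_absorb)
  then show ?thesis
    unfolding f(2) using f(1) s by (intro state_sum_relabel) auto
qed

lemma act_0:
  assumes op: "indexed_quandle op" and e: "e = 1 \<or> e = -1"
  shows "act op e 0 a a = a" "act op e 0 a b = b \<longleftrightarrow> a = b"
proof -
  have idem: "op 0 a a = a" for a
    using op by (simp add: indexed_quandle_def)
  show act: "act op e 0 a a = a" for a
    using e indexed_quandle_inverse(2)[OF op, of 0 a a] by (auto simp: act_def idem)
  show "act op e 0 a b = b \<longleftrightarrow> a = b"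
    using act_inverse(2)[OF op e, of 0 a b] act_inverse(2)[OF op e, of 0 b b] act[of b] by metis
qed

text \<open>The adjacent ends of the new chord have opposite values, so the old rises persist. Its
  own rise is 0, where the first axiom and \<open>\<phi> a a = 0\<close> apply.\<close>

lemma diag_sum_r1:
  assumes op: "indexed_quandle op" and \<phi>: "iq_cocycle op \<phi>" and m: "r1_move K K'"
  shows "diag_sum op \<phi> K = diag_sum op \<phi> K'"
proof -
  obtain A B c e ov where c: "c \<notin> labels (fst K)" and e: "e = 1 \<or> e = -1"
    and K: "fst K = A @ B" and K': "fst K' = A @ [(c, ov), (c, \<not> ov)] @ B"
    and s: "snd K' = (snd K)(c := e)"
    using m unfolding r1_move_def by blast
  have cAB: "c \<notin> labels A" "c \<notin> labels B"
    using c K by auto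
  have "rise K d = rise K' d" if "d \<in> labels (fst K)" for d
    using that c cAB by (auto simp: rise_def K K' s height_append val_def)
  moreover have rc: "rise K' c = 0"
    using cAB by (cases ov) (auto simp: rise_def K' s height_append val_def notin_labels)
  ultimately have "diag_sum op \<phi> K = state_sum (\<lambda>c. act op (snd K' c) (rise K' c))
      (\<lambda>c. act_weight op \<phi> (snd K' c) (rise K' c)) (fst K)"
    using c by (intro diag_sum_eq_state_sum) (auto simp: s)
  also have "\<dots> = diag_sum op \<phi> K'"
    unfolding K K'
  proof (rule state_sum_r1)
    show "act_weight op \<phi> (snd K' c) (rise K' c) a a = 0" for a
      using \<phi> by (simp add: act_weight_def rc s act_0[OF op e] iq_cocycle_def)
  qed (use cAB in \<open>simp_all add: rc s act_0[OF op e]\<close>)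
  finally show ?thesis .
qed

text \<open>The new entries form adjacent pairs of total 0, so the old rises persist. The new
  crossings have equal rise and opposite signs, hence act inversely.\<close>

lemma diag_sum_r2:
  assumes op: "indexed_quandle op" and m: "r2_move K K'"
  shows "diag_sum op \<phi> K = diag_sum op \<phi> K'"
proof -
  obtain A B C c d e rv where cd: "c \<notin> labels (fst K)" "d \<notin> labels (fst K)" "c \<noteq> d"
    and e: "e = 1 \<or> e = -1" and K: "fst K = A @ B @ C"
    and K': "fst K' = A @ [(c, True), (d, True)] @ B @
        (if rv then [(d, False), (c, False)] else [(c, False), (d, False)]) @ C"
    and s: "snd K' = (snd K)(c := e, d := - e)"
    using m unfolding r2_move_def by blast
  have c: "c \<notin> labels A" "c \<notin> labels B" "c \<notin> labels C" and d: "d \<notin> labels A" "d \<notin> labels B" "d \<notin> labels C"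
    using cd K by auto
  have "rise K v = rise K' v" if "v \<in> labels (fst K)" for v
  proof -
    have "v \<noteq> c" "v \<noteq> d"
      using that cd by auto
    then show ?thesis
      using c d cd(3) by (cases rv) (simp_all add: rise_def K K' s height_append val_def)
  qed
  then have "diag_sum op \<phi> K = state_sum (\<lambda>c. act op (snd K' c) (rise K' c))
      (\<lambda>c. act_weight op \<phi> (snd K' c) (rise K' c)) (fst K)"
    using cd by (intro diag_sum_eq_state_sum) (auto simp: s)
  also have "\<dots> = diag_sum op \<phi> K'"
    unfolding K K'
  proof (rule state_sum_r2)
    \<comment> \<open>From \<open>c\<close> to \<open>d\<close> the height drops by \<open>e\<close>
      at the over ends and grows by \<open>e\<close> at the under ends, in either order; the signs
      \<open>e\<close> and \<open>- e\<close> absorb this.\<close>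
    have r: "rise K' d = rise K' c"
      using c d cd(3) by (cases rv) (simp_all add: rise_def K' s height_append val_def notin_labels)
    have e': "- e = 1 \<or> - e = -1"
      using e by auto
    note act_inverse[OF op e] act_weight_cancel[OF op e] act_weight_cancel[OF op e', simplified]
    note [simp] = this
    show "act op (snd K' d) (rise K' d) (act op (snd K' c) (rise K' c) a b) b = a"
      "act op (snd K' c) (rise K' c) (act op (snd K' d) (rise K' d) a b) b = a"
      "act_weight op \<phi> (snd K' c) (rise K' c) a b +
        act_weight op \<phi> (snd K' d) (rise K' d) (act op (snd K' c) (rise K' c) a b) b = 0"
      "act_weight op \<phi> (snd K' d) (rise K' d) a b +
        act_weight op \<phi> (snd K' c) (rise K' c) (act op (snd K' d) (rise K' d) a b) b = 0" for a b
      using cd(3) by (simp_all add: r s)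
  qed (use cd K in auto)
  finally show ?thesis .
qed

section \<open>The third move\<close>

text \<open>For two positive crossings this is the third axiom together with the cocycle condition.
  A negative crossing applies an inverse, so its input is rewritten as an image; a negative
  \<open>y\<close> also exchanges the roles of \<open>b\<close> and \<open>b'\<close>.\<close>

lemma r3_local_act:
  assumes op: "indexed_quandle op" and \<phi>: "iq_cocycle op \<phi>"
    and y: "s y = 1 \<or> s y = -1" and z: "s z = 1 \<or> s z = -1"
    and b': "b' = op (r y - r z) b c"
  defines "T \<equiv> \<lambda>v. act op (s v) (r v)" and "V \<equiv> \<lambda>v. act_weight op \<phi> (s v) (r v)"
  shows "if s y = 1 then r3_local T V y z b b' c else r3_local T V y z b' b c"
proof -
  let ?y = "op (r y)" and ?z = "op (r z)"
  note inv = indexed_quandle_inverse[OF op]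
  have dist: "?y (?z a b) c = ?z (?y a c) b'" for a
    using op b' by (simp add: indexed_quandle_def)
  have coc: "\<phi> a c + \<phi> (?y a c) b' = \<phi> (?z a b) c + \<phi> a b" for a
  proof -
    \<comment> \<open>The cocycle condition at \<open>i = r y\<close> and
      \<open>j = r y - r z\<close>, so that \<open>i - j = r z\<close>.\<close>
    have "- \<phi> a c + \<phi> (op (r y - (r y - r z)) a b) c + \<phi> a b - \<phi> (?y a c) b' = 0"
      using \<phi> unfolding iq_cocycle_def b' by blast
    then show ?thesis
      by (simp add: algebra_simps)
  qed
  have coc': "\<phi> (?z a b) c = \<phi> a c + \<phi> (?y a c) b' - \<phi> a b" for a
    using coc[of a] by (simp add: algebra_simps)
  have surj: "\<exists>a'. a = op i a' d" for i a d
    using inv(1)[of i d a] by metis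
  consider "s y = 1" "s z = 1" | "s y = 1" "s z = -1" | "s y = -1" "s z = 1" | "s y = -1" "s z = -1"
    using y z by blast
  then show ?thesis
  proof cases
    case 1
    then show ?thesis
      by (simp add: r3_local_def T_def V_def act_def act_weight_def dist coc')
  next
    case 2
    have "T z (T y a c) b' = T y (T z a b) c \<and> V y a c + V z (T y a c) b' = V z a b + V y (T z a b) c" for a
    proof -
      \<comment> \<open>Writing the input as an image under \<open>?z\<close> lets every inverse be
        evaluated.\<close>
      obtain a' where "a = ?z a' b"
        using surj by blast
      with 2 show ?thesis
        by (simp add: T_def V_def act_def act_weight_def dist inv coc')
    qed
    with 2 show ?thesis
      by (simp add: r3_local_def)
  next
    case 3
    have "T z (T y a c) b = T y (T z a b') c \<and> V y a c + V z (T y a c) b = V z a b' + V y (T z a b') c" for a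
    proof -
      obtain a' where "a = ?y a' c"
        using surj by blast
      with 3 show ?thesis
        by (simp add: T_def V_def act_def act_weight_def dist[symmetric] inv coc')
    qed
    with 3 show ?thesis
      by (simp add: r3_local_def)
  next
    case 4
    have "T z (T y a c) b = T y (T z a b') c \<and> V y a c + V z (T y a c) b = V z a b' + V y (T z a b') c" for a
    proof -
      obtain a' where "a = ?y (?z a' b) c"
        using surj by metis
      \<comment> \<open>Here \<open>?y\<close> is outermost; distributivity brings \<open>?z\<close>
        outside, where its inverse cancels.\<close>
      moreover have "(THE a''. ?z a'' b' = ?y (?z a' b) c) = ?y a' c"
        by (simp add: dist inv)
      ultimately show ?thesis
        using 4 by (simp add: T_def V_def act_def act_weight_def inv coc')
    qed
    with 4 show ?thesis
      by (simp add: r3_local_def)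
  qed
qed

text \<open>Swapping adjacent entries shifts the height of each by plus or minus the value of the
  other, and the sign conditions make the shifts at both ends of a chord equal. With heights t, m, b
  at the top, middle and bottom strand, the rises of \<open>x\<close>, \<open>z\<close>,
  \<open>y\<close> are m - t, b - m, b - t up to corrections by signs, whence the
  additivity.\<close>

lemma rise_r3:
  assumes d: "distinct [x, y, z]" and xyz: "\<forall>v\<in>{x, y, z}. v \<notin> labels (A @ B @ C @ D)"
    and sy: "s y = sgnb sT * sgnb sM * s z" and sx: "s x = sgnb sT * sgnb sB * s z"
    and w: "(w = A @ segT x y sT @ B @ segM x z sM @ C @ segB y z sB @ D \<and>
       w' = A @ segT x y (\<not> sT) @ B @ segM x z (\<not> sM) @ C @ segB y z (\<not> sB) @ D) \<or>
      (w = A @ segT x y sT @ B @ segB y z sB @ C @ segM x z sM @ D \<and>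
       w' = A @ segT x y (\<not> sT) @ B @ segB y z (\<not> sB) @ C @ segM x z (\<not> sM) @ D)"
  shows "rise (w', s) v = rise (w, s) v" "rise (w, s) y = rise (w, s) x + rise (w, s) z"
proof -
  have n: "(u, b) \<notin> set W" if "u \<in> {x, y, z}" "W \<in> {A, B, C, D}" for u b W
    using that xyz by (auto intro!: notin_labels)
  have "rise (w', s) v = rise (w, s) v" if "v \<notin> {x, y, z}"
  proof -
    have "height s w' (v, b) = height s w (v, b)" for b
      using that w by (elim disjE conjE) (auto simp: height_append segT_def segM_def segB_def)
    then show ?thesis by (simp add: rise_def)
  qed
  moreover have "rise (w', s) x = rise (w, s) x \<and> rise (w', s) y = rise (w, s) y \<and>
      rise (w', s) z = rise (w, s) z \<and> rise (w, s) y = rise (w, s) x + rise (w, s) z"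
    using w
  proof (elim disjE conjE)
    assume w: "w = A @ segT x y sT @ B @ segM x z sM @ C @ segB y z sB @ D"
      "w' = A @ segT x y (\<not> sT) @ B @ segM x z (\<not> sM) @ C @ segB y z (\<not> sB) @ D"
    show ?thesis
      using d sx sy unfolding w
      by - (cases sT; cases sM; cases sB;
          simp add: rise_def height_append segT_def segM_def segB_def n val_def sgnb_def)
  next
    assume w: "w = A @ segT x y sT @ B @ segB y z sB @ C @ segM x z sM @ D"
      "w' = A @ segT x y (\<not> sT) @ B @ segB y z (\<not> sB) @ C @ segM x z (\<not> sM) @ D"
    show ?thesis
      using d sx sy unfolding w
      by - (cases sT; cases sM; cases sB;
          simp add: rise_def height_append segT_def segM_def segB_def n val_def sgnb_def)
  qed
  ultimately show "rise (w', s) v = rise (w, s) v" "rise (w, s) y = rise (w, s) x + rise (w, s) z"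
    by auto
qed

lemma diag_sum_r3:
  assumes op: "indexed_quandle op" and \<phi>: "iq_cocycle op \<phi>" and K: "gd_wf K" and m: "r3_move K K'"
  shows "diag_sum op \<phi> K = diag_sum op \<phi> K'"
proof -
  obtain A B C D x y z sT sM sB where d: "distinct [x, y, z]"
    and sgn: "sgnb sT * sgnb sM = snd K y * snd K z" "sgnb sT * sgnb sB = snd K x * snd K z"
    and s: "snd K' = snd K"
    and w: "(fst K = A @ segT x y sT @ B @ segM x z sM @ C @ segB y z sB @ D \<and>
       fst K' = A @ segT x y (\<not> sT) @ B @ segM x z (\<not> sM) @ C @ segB y z (\<not> sB) @ D) \<or>
      (fst K = A @ segT x y sT @ B @ segB y z sB @ C @ segM x z sM @ D \<and>
       fst K' = A @ segT x y (\<not> sT) @ B @ segB y z (\<not> sB) @ C @ segM x z (\<not> sM) @ D)"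
    using m unfolding r3_move_def by blast
  have "distinct (fst K)"
    using K by (simp add: gd_wf_def)
  then have xyz: "\<forall>v\<in>{x, y, z}. v \<notin> labels (A @ B @ C @ D)"
    using w by (elim disjE conjE) (auto simp: mem_labels_iff segT_def segM_def segB_def split: if_splits)
  have "{x, y, z} \<subseteq> labels (fst K)"
    using w by (elim disjE conjE) (auto simp: segT_def segM_def segB_def)
  then have pm: "snd K x = 1 \<or> snd K x = -1" "snd K y = 1 \<or> snd K y = -1" "snd K z = 1 \<or> snd K z = -1"
    using K by (auto simp: gd_wf_def)
  have sy: "snd K y = sgnb sT * sgnb sM * snd K z" and sx: "snd K x = sgnb sT * sgnb sB * snd K z"
    using sgn pm by auto
  have rise: "rise K' v = rise K v" "rise K y = rise K x + rise K z" for v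
    using rise_r3[OF d xyz sy sx w] s by (metis prod.collapse)+
  let ?T = "\<lambda>v. act op (snd K v) (rise K v)" and ?V = "\<lambda>v. act_weight op \<phi> (snd K v) (rise K v)"
  have loc: "if sM = sB then r3_local ?T ?V y z b (?T x b c) c else r3_local ?T ?V y z (?T x b c) b c" for b c
  proof -
    \<comment> \<open>Both signs share the nonzero factors \<open>sgnb sT\<close> and
      \<open>snd K z\<close>, so they agree exactly when \<open>sM\<close> and \<open>sB\<close>
      do.\<close>
    have sMB: "sM = sB \<longleftrightarrow> snd K x = snd K y"
      using sx sy pm(3) by (auto simp: sgnb_def split: if_splits)
    have core: "if snd K y = 1 then r3_local ?T ?V y z b b' c else r3_local ?T ?V y z b' b c"
      if "b' = op (rise K x) b c" for b b'
      using r3_local_act[OF op \<phi> pm(2,3), of b' "rise K" b c] that rise(2) by simp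
    \<comment> \<open>A positive \<open>x\<close> takes \<open>b\<close> to \<open>?T x b c\<close>
      by the operation of index \<open>rise K x\<close>. A negative one inverts that operation, so
      the two colors trade places in \<open>core\<close>.\<close>
    show ?thesis
      using pm(1,2) core[of "?T x b c" b] core[of b "?T x b c"] unfolding sMB
      by (auto simp: act_def indexed_quandle_inverse[OF op])
  qed
  \<comment> \<open>The inverse \<open>Ti\<close> of crossing \<open>x\<close> is the action of the
    opposite sign at the same index.\<close>
  have "state_sum ?T ?V (fst K) = state_sum ?T ?V (fst K')"
    using state_sum_r3[OF d xyz _ _ loc w, of "act op (- snd K x) (rise K x)"] act_inverse[OF op pm(1)]
    by blast
  then show ?thesis
    by (simp add: s rise(1))
qed

lemma Phi_move:
  assumes "indexed_quandle op" "iq_cocycle op \<phi>" "gd_move K K'"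
  shows "Phi op \<phi> K = Phi op \<phi> K'"
proof -
  have wf: "gd_wf K" "gd_wf K'"
    using assms(3) by (auto simp: gd_move_def)
  have "diag_sum op \<phi> K = diag_sum op \<phi> K'"
    using assms(3) unfolding gd_move_def
    by (elim conjE disjE) (erule (1) diag_sum_rot, erule diag_sum_relabel, erule diag_sum_r1[OF assms(1,2)],
        erule diag_sum_r2[OF assms(1)], erule (1) diag_sum_r3[OF assms(1,2)])
  then show ?thesis
    by (simp only: Phi_eq_diag_sum[OF assms(1)] wf)
qed

theorem theorem5p9:
  fixes op :: "int \<Rightarrow> 'q::finite \<Rightarrow> 'q \<Rightarrow> 'q"
    and \<phi> :: "'q \<Rightarrow> 'q \<Rightarrow> 'a::ab_group_add"
    and K K' :: gdiag
  assumes "indexed_quandle op"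
    and "iq_cocycle op \<phi>"
    and "virt_equiv K K'"
  shows "Phi op \<phi> K = Phi op \<phi> K'"
  using assms(3) unfolding virt_equiv_def
proof (induction rule: rtranclp_induct)
  case (step L L')
  then show ?case
    using Phi_move[OF assms(1,2)] by metis
qed simp

end
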